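(* Let $q>2$ and $n\ge 1$ be integers. There is no affine function $f:\mathbb{Z}_q^n\to\mathbb{Z}_q$ (i.e. $f(\mathbf{x})=\langle\mathbf{a},\mathbf{x}\rangle+b$ with $\mathbf{a}\in\mathbb{Z}_q^n$, $b\in\mathbb{Z}_q$) such that $|\mathcal{N}'_f(\mathbf{u})|=1$ for all $\mathbf{u}\in\mathbb{Z}_q^n$.
   Context: $\mathbb{Z}_q$ is the ring of integers modulo $q$. For $x\in\mathbb{Z}_q$, $\hat{x}\in\{0,\ldots,q-1\}$ is its least non-negative integer representative, and $\hat{\mathbf{x}}=(\hat{x}_1,\ldots,\hat{x}_n)$ for $\mathbf{x}\in\mathbb{Z}_q^n$. Let $\xi$ be a primitive $q$-th root of unity and $\omega$ a primitive $2q$-th root of unity. For $f:\mathbb{Z}_q^n\to\mathbb{Z}_q$, the $q$-nega-Hadamard transform is $$\mathcal{N}'_f(\mathbf{u})=\frac{1}{q^{n/2}}\sum_{\mathbf{x}\in\mathbb{Z}_q^n}\xi^{f(\mathbf{x})}\,\xi^{\langle\hat{\mathbf{x}},\hat{\mathbf{u}}\rangle}\,\omega^{\sum_i\hat{x}_i},\qquad \mathbf{u}\in\mathbb{Z}_q^n,$$ where $\langle\hat{\mathbf{x}},\hat{\mathbf{u}}\rangle=\sum_i\hat x_i\hat u_i$. *)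

theory Defs
  imports "HOL-Analysis.Analysis" "Berlekamp_Zassenhaus.Finite_Field"
begin

text \<open>The ring of integers modulo q is \<^typ>\<open>'q mod_ring\<close> with q = \<^term>\<open>CARD('q)\<close>, and its n-th
  power is \<^typ>\<open>'q mod_ring ^ 'n\<close> with n = \<^term>\<open>CARD('n)\<close>; as \<^typ>\<open>'n\<close> is nonempty, n is at least 1.\<close>

definition primitive_root_of_unity :: "nat \<Rightarrow> complex \<Rightarrow> bool" where
  "primitive_root_of_unity k z \<longleftrightarrow> k > 0 \<and> z ^ k = 1 \<and> (\<forall>j. 0 < j \<and> j < k \<longrightarrow> z ^ j \<noteq> 1)"

text \<open>The least non-negative representative as a natural number.\<close>

definition rep :: "'q::finite mod_ring \<Rightarrow> nat" where
  "rep x = nat (to_int_mod_ring x)"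

text \<open>Raising \<open>\<xi>\<close> to an element of the residue ring means raising it to its representative,
  which is independent of the choice of representative for a q-th root of unity. All sums in
  the exponents other than \<open>f x\<close> itself are sums of natural numbers, not taken modulo q.\<close>

definition q_nega_Hadamard ::
    "complex \<Rightarrow> complex \<Rightarrow> ('q::finite mod_ring ^ 'n::finite \<Rightarrow> 'q mod_ring) \<Rightarrow> 'q mod_ring ^ 'n \<Rightarrow> complex" where
  "q_nega_Hadamard \<xi> \<omega> f u =
     1 / of_real (real CARD('q) powr (real CARD('n) / 2)) *
     (\<Sum>x\<in>UNIV. \<xi> ^ rep (f x) * \<xi> ^ (\<Sum>i\<in>UNIV. rep (x $ i) * rep (u $ i)) * \<omega> ^ (\<Sum>i\<in>UNIV. rep (x $ i)))"

definition affine_function :: "('q::finite mod_ring ^ 'n::finite \<Rightarrow> 'q mod_ring) \<Rightarrow> bool" where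
  "affine_function f \<longleftrightarrow> (\<exists>a b. \<forall>x. f x = (\<Sum>i\<in>UNIV. a $ i * x $ i) + b)"

end

theory Submission
  imports Defs
begin

text \<open>The transform of an affine function with linear part a factors, up to a constant of modulus
  \<open>q powr (- n / 2)\<close>, as the product over i of the geometric sums of length q with ratio
  \<open>\<xi> ^ (a i + u i) * \<omega>\<close>; the q-th power of the ratio is -1, so each sum is 2 / (1 - ratio).
  Choosing u so that \<open>a i + u i = c\<close> for all i shows that a flat spectrum forces
  all the q distinct points \<open>\<xi> ^ c * \<omega>\<close> of the unit circle to be equidistant from 1.
  At most two points of the unit circle have a given distance from 1.\<close>

lemma bij_betw_rep: "bij_betw rep (UNIV :: 'q::finite mod_ring set) {..<CARD('q)}"
proof -
  have "bij_betw to_int_mod_ring (UNIV :: 'q mod_ring set) {0..<int CARD('q)}"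
    using range_to_int_mod_ring to_int_mod_ring_hom.injectivity
    by (simp add: bij_betw_def inj_on_def)
  moreover have "bij_betw nat {0..<int CARD('q)} {..<CARD('q)}"
    by (rule bij_betwI[where g = int]) auto
  ultimately show ?thesis
    using bij_betw_trans by (fastforce simp: rep_def [abs_def] o_def)
qed

lemma rep_add: "rep (x + y :: 'q::finite mod_ring) = (rep x + rep y) mod CARD('q)"
  unfolding rep_def by transfer (auto simp: nat_mod_distrib nat_add_distrib)

lemma rep_mult: "rep (x * y :: 'q::finite mod_ring) = (rep x * rep y) mod CARD('q)"
  unfolding rep_def by transfer (auto simp: nat_mod_distrib nat_mult_distrib)

lemma rep_0: "rep (0 :: 'q::finite mod_ring) = 0"
  unfolding rep_def by transfer simp

lemma power_mod_exponent:
  fixes z :: "'a::monoid_mult"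
  assumes "z ^ q = 1"
  shows "z ^ (m mod q) = z ^ m"
proof -
  have "z ^ m = z ^ (q * (m div q) + m mod q)"
    by simp
  also have "\<dots> = z ^ (m mod q)"
    by (simp only: power_add power_mult assms power_one mult_1_left)
  finally show ?thesis ..
qed

text \<open>Reducing an exponent modulo q does not change a power of \<open>z\<close>, so
  \<open>z ^ rep _\<close> turns addition in the residue ring into multiplication. This allows
  exponents in the residue ring and natural exponents to be mixed.\<close>

lemma power_rep_add:
  fixes x y :: "'q::finite mod_ring" and z :: "'a::monoid_mult"
  assumes "z ^ CARD('q) = 1"
  shows "z ^ rep (x + y) = z ^ rep x * z ^ rep y"
  by (simp add: rep_add power_mod_exponent[OF assms] power_add)

lemma power_rep_mult:
  fixes x y :: "'q::finite mod_ring" and z :: "'a::monoid_mult"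
  assumes "z ^ CARD('q) = 1"
  shows "z ^ rep (x * y) = z ^ (rep x * rep y)"
  by (simp add: rep_mult power_mod_exponent[OF assms])

lemma power_rep_sum:
  fixes g :: "'i \<Rightarrow> 'q::finite mod_ring" and z :: "'a::comm_monoid_mult"
  assumes "z ^ CARD('q) = 1"
  shows "z ^ rep (sum g A) = (\<Prod>i\<in>A. z ^ rep (g i))"
  by (induction A rule: infinite_finite_induct) (simp_all add: rep_0 power_rep_add[OF assms])

lemma sum_power_rep:
  fixes z :: "'a::semiring_1"
  shows "(\<Sum>y\<in>(UNIV :: 'q::finite mod_ring set). z ^ rep y) = (\<Sum>k<CARD('q). z ^ k)"
  by (rule sum.reindex_bij_betw[OF bij_betw_rep])

text \<open>Distributivity: expanding a product of n copies of one sum gives a summand for each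
  choice function, that is, for each vector. This decouples the coordinates of the
  transform.\<close>

lemma sum_vec_prod:
  fixes g :: "'b::finite \<Rightarrow> 'a::comm_semiring_1"
  shows "(\<Sum>x\<in>(UNIV :: ('b ^ 'n::finite) set). \<Prod>i\<in>UNIV. g (x $ i)) = (\<Sum>y\<in>UNIV. g y) ^ CARD('n)"
proof -
  have "bij (($) :: 'b ^ 'n \<Rightarrow> 'n \<Rightarrow> 'b)"
    by (rule bijI') (auto simp: vec_eq_iff intro: exI[of _ "vec_lambda _"] vec_lambda_inverse[symmetric])
  then have "(\<Sum>x\<in>(UNIV :: ('b ^ 'n) set). \<Prod>i\<in>UNIV. g (x $ i)) = (\<Sum>h\<in>UNIV. \<Prod>i\<in>(UNIV :: 'n set). g (h i))"
    by (rule sum.reindex_bij_betw)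
  also have "\<dots> = (\<Prod>i\<in>(UNIV :: 'n set). \<Sum>y\<in>UNIV. g y)"
    by (subst prod_sum_PiE) auto
  finally show ?thesis
    by simp
qed

text \<open>Evaluating at \<open>c - a\<close> cancels the linear part of \<open>f\<close>, so every
  coordinate contributes the same geometric sum, whatever \<open>a\<close> is.\<close>

lemma q_nega_Hadamard_affine:
  fixes a :: "'q::finite mod_ring ^ 'n::finite"
  assumes xi: "\<xi> ^ CARD('q) = 1"
    and f: "\<And>x. f x = (\<Sum>i\<in>UNIV. a $ i * x $ i) + b"
  shows "q_nega_Hadamard \<xi> \<omega> f (\<chi> i. c - a $ i) =
    \<xi> ^ rep b / of_real (real CARD('q) powr (real CARD('n) / 2)) *
    (\<Sum>k<CARD('q). (\<xi> ^ rep c * \<omega>) ^ k) ^ CARD('n)"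
proof -
  let ?u = "\<chi> i. c - a $ i"
  have factor: "\<xi> ^ rep (a $ i * x $ i) * \<xi> ^ (rep (x $ i) * rep (?u $ i)) = (\<xi> ^ rep c) ^ rep (x $ i)"
    for x :: "'q mod_ring ^ 'n" and i
  proof -
    have "\<xi> ^ rep (a $ i * x $ i) * \<xi> ^ (rep (x $ i) * rep (?u $ i))
        = \<xi> ^ rep (a $ i * x $ i + x $ i * (c - a $ i))"
      by (simp add: power_rep_add[OF xi] power_rep_mult[OF xi])
    also have "a $ i * x $ i + x $ i * (c - a $ i) = c * x $ i"
      by (simp add: algebra_simps)
    finally show ?thesis
      by (simp add: power_rep_mult[OF xi] power_mult)
  qed
  have "\<xi> ^ rep (f x) * \<xi> ^ (\<Sum>i\<in>UNIV. rep (x $ i) * rep (?u $ i)) * \<omega> ^ (\<Sum>i\<in>UNIV. rep (x $ i))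
      = \<xi> ^ rep b * (\<Prod>i\<in>UNIV. (\<xi> ^ rep c * \<omega>) ^ rep (x $ i))" for x
  proof -
    \<comment> \<open>No exponent of \<open>\<omega>\<close> is reduced modulo q, as
      \<open>\<omega> ^ CARD('q)\<close> need not be 1; that exponent splits as a sum of natural
      numbers.\<close>
    have "\<xi> ^ rep (f x) * \<xi> ^ (\<Sum>i\<in>UNIV. rep (x $ i) * rep (?u $ i)) * \<omega> ^ (\<Sum>i\<in>UNIV. rep (x $ i))
        = \<xi> ^ rep b * (\<Prod>i\<in>UNIV. \<xi> ^ rep (a $ i * x $ i) * \<xi> ^ (rep (x $ i) * rep (?u $ i)) * \<omega> ^ rep (x $ i))"
      by (simp only: f power_rep_add[OF xi] power_rep_sum[OF xi] power_sum prod.distrib mult_ac)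
    then show ?thesis
      by (simp only: factor power_mult_distrib)
  qed
  then show ?thesis
    by (simp add: q_nega_Hadamard_def sum_distrib_left[symmetric]
        sum_vec_prod[of "\<lambda>y. (\<xi> ^ rep c * \<omega>) ^ rep y"] sum_power_rep)
qed

text \<open>On the unit circle the squared distance from 1 is \<open>2 - 2 * Re w\<close>. It
  determines the real part, hence the imaginary part up to sign, which leaves at most two
  points.\<close>

lemma unit_circle_equidistant_from_one:
  fixes x y z :: complex
  assumes "cmod x = 1" "cmod y = 1" "cmod z = 1"
    and "cmod (1 - x) = cmod (1 - y)" "cmod (1 - x) = cmod (1 - z)"
  shows "x = y \<or> x = z \<or> y = z"
proof -
  have *: "(cmod (1 - w))\<^sup>2 = 2 - 2 * Re w" "(Im w)\<^sup>2 = 1 - (Re w)\<^sup>2" if "cmod w = 1" for w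
  proof -
    have "(Re w)\<^sup>2 + (Im w)\<^sup>2 = 1"
      using that cmod_power2[of w] by simp
    then show "(cmod (1 - w))\<^sup>2 = 2 - 2 * Re w" "(Im w)\<^sup>2 = 1 - (Re w)\<^sup>2"
      unfolding cmod_power2 by (simp_all add: power2_diff)
  qed
  have Re: "Re x = Re y" "Re x = Re z"
    using *(1)[OF assms(1)] *(1)[OF assms(2)] *(1)[OF assms(3)] assms(4,5) by simp_all
  then have "(Im x)\<^sup>2 = (Im y)\<^sup>2" "(Im x)\<^sup>2 = (Im z)\<^sup>2"
    using *(2) assms(1-3) by simp_all
  then show ?thesis
    using Re by (auto simp: power2_eq_iff complex_eq_iff)
qed

lemma primitive_root_of_unity_norm:
  assumes "primitive_root_of_unity k z"
  shows "cmod z = 1"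
  using assms by (metis power_eq_1_iff primitive_root_of_unity_def)

text \<open>\<open>z ^ q\<close> is a square root of 1, and primitivity excludes 1 itself because 0
  < q < 2q.\<close>

lemma primitive_root_of_unity_half:
  assumes "primitive_root_of_unity (2 * q) z"
  shows "z ^ q = -1"
proof -
  have "(z ^ q)\<^sup>2 = 1"
    using assms by (simp add: primitive_root_of_unity_def power_mult[symmetric] mult.commute)
  moreover have "z ^ q \<noteq> 1"
    using assms by (auto simp: primitive_root_of_unity_def)
  ultimately show ?thesis
    by (simp add: power2_eq_1_iff)
qed

theorem theorem2:
  fixes \<xi> \<omega> :: complex
  assumes "CARD('q::finite) > 2"
    and "primitive_root_of_unity CARD('q) \<xi>"
    and "primitive_root_of_unity (2 * CARD('q)) \<omega>"
  shows "\<not> (\<exists>f :: 'q mod_ring ^ 'n::finite \<Rightarrow> 'q mod_ring.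
              affine_function f \<and> (\<forall>u. cmod (q_nega_Hadamard \<xi> \<omega> f u) = 1))"
proof
  assume "\<exists>f :: 'q mod_ring ^ 'n::finite \<Rightarrow> 'q mod_ring.
              affine_function f \<and> (\<forall>u. cmod (q_nega_Hadamard \<xi> \<omega> f u) = 1)"
  then obtain f :: "'q mod_ring ^ 'n \<Rightarrow> 'q mod_ring" and a b
    where f: "\<And>x. f x = (\<Sum>i\<in>UNIV. a $ i * x $ i) + b"
      and flat: "\<And>u. cmod (q_nega_Hadamard \<xi> \<omega> f u) = 1"
    unfolding affine_function_def by blast
  have xi: "\<xi> ^ CARD('q) = 1"
    using assms(2) by (simp add: primitive_root_of_unity_def)
  note norm_xi = primitive_root_of_unity_norm[OF assms(2)]
    and norm_om = primitive_root_of_unity_norm[OF assms(3)]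
    and om = primitive_root_of_unity_half[OF assms(3)]
  define C where "C = real CARD('q) powr (real CARD('n) / 2)"
  have "C > 0"
    by (simp add: C_def)
  \<comment> \<open>What matters is that the right-hand side does not depend on
    \<open>k\<close>.\<close>
  have dist: "cmod (1 - \<xi> ^ k * \<omega>) ^ CARD('n) = 2 ^ CARD('n) / C" if "k < CARD('q)" for k
  proof -
    have "k \<in> range (rep :: 'q mod_ring \<Rightarrow> nat)"
      unfolding bij_betw_imp_surj_on[OF bij_betw_rep] using that by simp
    then obtain c :: "'q mod_ring" where c: "rep c = k"
      by blast
    have "(\<xi> ^ k) ^ CARD('q) = (\<xi> ^ CARD('q)) ^ k"
      by (simp only: power_mult[symmetric] mult.commute)
    \<comment> \<open>The value -1 serves twice: the ratio cannot be 1, and the numerator of the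
      geometric sum becomes 1 - (-1) = 2.\<close>
    then have "(\<xi> ^ k * \<omega>) ^ CARD('q) = -1"
      by (simp add: power_mult_distrib xi om)
    moreover from this have ne: "\<xi> ^ k * \<omega> \<noteq> 1"
      by auto
    ultimately have "(\<Sum>j<CARD('q). (\<xi> ^ k * \<omega>) ^ j) = 2 / (1 - \<xi> ^ k * \<omega>)"
      by (simp add: sum_gp_strict)
    then have "1 = cmod (\<xi> ^ rep b / of_real C * (2 / (1 - \<xi> ^ k * \<omega>)) ^ CARD('n))"
      using flat[of "\<chi> i. c - a $ i"] by (simp only: q_nega_Hadamard_affine[OF xi f] c C_def)
    also have "\<dots> = 2 ^ CARD('n) / (C * cmod (1 - \<xi> ^ k * \<omega>) ^ CARD('n))"
      using \<open>C > 0\<close> by (simp add: norm_mult norm_divide norm_power norm_xi power_divide)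
    finally show ?thesis
      using \<open>C > 0\<close> ne by (simp add: field_simps)
  qed
  \<comment> \<open>The point with exponent 0 is the reference. Equal n-th powers of nonnegative
    reals have equal bases, as n is positive.\<close>
  have eq: "cmod (1 - \<xi> ^ 0 * \<omega>) = cmod (1 - \<xi> ^ k * \<omega>)" if "k < CARD('q)" for k
  proof (rule power_eq_imp_eq_base)
    show "cmod (1 - \<xi> ^ 0 * \<omega>) ^ CARD('n) = cmod (1 - \<xi> ^ k * \<omega>) ^ CARD('n)"
      unfolding dist[OF that] by (rule dist) simp
  qed simp_all
  have unit: "cmod (\<xi> ^ k * \<omega>) = 1" for k
    by (simp add: norm_mult norm_power norm_xi norm_om)
  \<comment> \<open>Since q > 2, the exponents 0, 1 and 2 are all below q and give three equidistant
    points.\<close>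
  have "\<xi> ^ 0 * \<omega> = \<xi> ^ 1 * \<omega> \<or> \<xi> ^ 0 * \<omega> = \<xi> ^ 2 * \<omega> \<or> \<xi> ^ 1 * \<omega> = \<xi> ^ 2 * \<omega>"
    by (rule unit_circle_equidistant_from_one[OF unit unit unit eq eq]) (use assms(1) in simp_all)
  moreover have "\<omega> \<noteq> 0" "\<xi> \<noteq> 0"
    using norm_xi norm_om by auto
  \<comment> \<open>Cancel \<open>\<omega>\<close>, and in the third case also one factor
    \<open>\<xi>\<close>; either outcome contradicts that \<open>\<xi>\<close> has order q >
    2.\<close>
  ultimately have "\<xi> ^ 1 = 1 \<or> \<xi> ^ 2 = 1"
    by (auto simp: power2_eq_square)
  moreover have "\<xi> ^ 1 \<noteq> 1" "\<xi> ^ 2 \<noteq> 1"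
    using assms(1,2) by (simp_all only: primitive_root_of_unity_def) auto
  ultimately show False
    by blast
qed

end
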